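(* Let $d\in\{1,2\}$. There exist normalizing constants $a_{N,d}$ such that $$a_{N,d}\,(Z(N)-1)\Rightarrow \xi\quad (N\to\infty),$$ where $\xi$ is some Gaussian random variable and $\Rightarrow$ denotes convergence in distribution under $Q$.
   Context: For $N\ge 1$, $P^N_0$ is the uniform probability measure on nearest-neighbour walks $\omega:\{0,\dots,N\}\to\mathbb{Z}^d$ with $\omega(0)=0$, $|\omega(n)-\omega(n-1)|=1$. The environment $h=\{h(n,x):n\in\mathbb{N},x\in\mathbb{Z}^d\}$ is i.i.d. with $h(n,x)=\pm1$ each with probability $1/2$ on $(H,\mathcal{G},Q)$, independent of the walk. $(c_{N,d})$ is a sequence of positive numbers with $\lim_{N\to\infty}c_{N,1}^2N^{1/2}=0$ for $d=1$ and $\lim_{N\to\infty}c_{N,2}^2\log N=0$ for $d=2$. $Z(N)=\int\prod_{n=1}^N[1+c_{N,d}h(n,\omega(n))]\,dP^N_0(\omega)$. *)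

theory Defs
  imports "HOL-Probability.Probability"
begin

definition lattice :: "nat \<Rightarrow> int list set" where
  "lattice d = {x. length x = d}"

definition nn :: "int list \<Rightarrow> int list \<Rightarrow> bool" where
  "nn x y \<longleftrightarrow> length x = length y \<and> (\<Sum>i<length x. \<bar>x ! i - y ! i\<bar>) = 1"

definition walks :: "nat \<Rightarrow> nat \<Rightarrow> (nat \<Rightarrow> int list) set" where
  "walks d N = {\<omega> \<in> {0..N} \<rightarrow>\<^sub>E lattice d.
      \<omega> 0 = replicate d 0 \<and> (\<forall>n\<in>{1..N}. nn (\<omega> (n - 1)) (\<omega> n))}"

definition partition_fn ::
    "nat \<Rightarrow> (nat \<Rightarrow> real) \<Rightarrow> (nat \<Rightarrow> int list \<Rightarrow> real) \<Rightarrow> nat \<Rightarrow> real" where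
  "partition_fn d c h N =
     (\<Sum>\<omega>\<in>walks d N. \<Prod>n=1..N. (1 + c N * h n (\<omega> n))) / real (card (walks d N))"

end

theory Submission
  imports Defs
begin

text \<open>
  Expand \<open>Z - 1\<close> in powers of the disorder. The linear term is \<open>c\<close> times a sum of independent signs whose
  weights are the transition probabilities \<open>p\<^sub>n(x)\<close>; its variance is \<open>c\<^sup>2 R\<close>, where \<open>R\<close> is the expected number of
  collisions up to time \<open>N\<close> of two independent walks. For two independent walks with \<open>L\<close> collisions, the
  second moment of everything beyond the linear term is the mean of \<open>(1 + c\<^sup>2)^L - 1 - c\<^sup>2 L\<close>, which the Markov
  property bounds by \<open>(c\<^sup>2 R)\<^sup>2 / (1 - c\<^sup>2 R)\<close>. Since \<open>R\<close> has order \<open>N^(1/2)\<close> for \<open>d = 1\<close> and \<open>log N\<close> for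
  \<open>d = 2\<close>, the hypothesis on \<open>c\<close> says \<open>c\<^sup>2 R \<rightarrow> 0\<close>, so with \<open>a = 1 / (c R^(1/2))\<close> only the linear term
  survives. As \<open>R\<close> tends to infinity, its normalized weights are uniformly small, and it is
  asymptotically standard normal.
\<close>

section \<open>Sums of weighted random signs\<close>

lemma cos_minus_exp_bound:
  fixes u :: real
  shows "\<bar>cos u - exp (- (u\<^sup>2) / 2)\<bar> \<le> u ^ 4"
proof -
  have "\<exists>t. \<bar>t\<bar> \<le> \<bar>u\<bar> \<and>
      cos u = (\<Sum>m<4. cos_coeff m * u ^ m) + (cos (t + 1/2 * real 4 * pi) / fact 4) * u ^ 4"
    using Maclaurin_cos_expansion[of u 4] by simp
  then obtain t where t: "cos u = (\<Sum>m<4. cos_coeff m * u ^ m) + (cos (t + 1/2 * real 4 * pi) / fact 4) * u ^ 4"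
    by blast
  have s: "(\<Sum>m<4. cos_coeff m * u ^ m) = 1 - u\<^sup>2 / 2"
  proof -
    have "{..<4} = {0, 1, 2, 3 :: nat}" by auto
    then show ?thesis by (simp add: cos_coeff_def)
  qed
  have "\<bar>cos u - (1 - u\<^sup>2 / 2)\<bar> = \<bar>cos (t + 1/2 * real 4 * pi)\<bar> * (u ^ 4 / fact 4)"
    unfolding t s by (simp add: abs_mult)
  also have "\<dots> \<le> 1 * (u ^ 4 / fact 4)"
    by (intro mult_right_mono abs_cos_le_one) simp
  also have "\<dots> \<le> u ^ 4 / 2"
    by (simp add: fact_numeral)
  finally have 1: "\<bar>cos u - (1 - u\<^sup>2 / 2)\<bar> \<le> u ^ 4 / 2" .
  define v where "v = u\<^sup>2 / 2"
  have v: "v \<ge> 0" by (simp add: v_def)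
  have "exp (- v) \<ge> 1 - v"
    using exp_ge_add_one_self[of "- v"] by simp
  moreover have "exp (- v) \<le> 1 - v + v\<^sup>2"
  proof -
    have "exp (- v) = 1 / exp v" by (simp add: exp_minus field_simps)
    also have "\<dots> \<le> 1 / (1 + v)"
      using v exp_ge_add_one_self[of v] by (intro divide_left_mono) auto
    also have "\<dots> \<le> 1 - v + v\<^sup>2"
      using v by (simp add: field_simps power2_eq_square)
    finally show ?thesis .
  qed
  ultimately have 2: "\<bar>exp (- v) - (1 - v)\<bar> \<le> v\<^sup>2" by simp
  have 3: "v\<^sup>2 = u ^ 4 / 4" by (simp add: v_def power_divide flip: power_mult)
  have "u ^ 4 \<ge> 0" by simp
  then have "\<bar>cos u - exp (- v)\<bar> \<le> u ^ 4"
    using 1 2 unfolding 3 v_def[symmetric] by linarith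
  then show ?thesis by (simp add: v_def)
qed

lemma prod_cos_tendsto_gaussian:
  fixes \<alpha> :: "nat \<Rightarrow> 'i \<Rightarrow> real"
  assumes fin: "\<And>N. finite (J N)"
    and norm1: "\<forall>\<^sub>F N in sequentially. (\<Sum>i\<in>J N. (\<alpha> N i)\<^sup>2) = 1"
    and small: "\<And>N i. i \<in> J N \<Longrightarrow> (\<alpha> N i)\<^sup>2 \<le> m N" and m: "m \<longlonglongrightarrow> 0"
  shows "(\<lambda>N. \<Prod>i\<in>J N. cos (t * \<alpha> N i)) \<longlonglongrightarrow> exp (- (t\<^sup>2) / 2)"
proof -
  have bnd: "norm ((\<Prod>i\<in>J N. cos (t * \<alpha> N i)) - exp (- (t\<^sup>2) / 2)) \<le> t ^ 4 * m N"
    if N: "(\<Sum>i\<in>J N. (\<alpha> N i)\<^sup>2) = 1" for N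
  proof -
    have e: "exp (- (t\<^sup>2) / 2) = (\<Prod>i\<in>J N. exp (- ((t * \<alpha> N i)\<^sup>2) / 2))"
    proof -
      have "(\<Sum>i\<in>J N. - ((t * \<alpha> N i)\<^sup>2) / 2) = - (t\<^sup>2) / 2 * (\<Sum>i\<in>J N. (\<alpha> N i)\<^sup>2)"
        unfolding sum_distrib_left by (intro sum.cong) (auto simp: power_mult_distrib)
      then show ?thesis using N by (simp add: exp_sum[OF fin, symmetric])
    qed
    have "norm ((\<Prod>i\<in>J N. cos (t * \<alpha> N i)) - exp (- (t\<^sup>2) / 2))
        \<le> (\<Sum>i\<in>J N. norm (cos (t * \<alpha> N i) - exp (- ((t * \<alpha> N i)\<^sup>2) / 2)))"
      unfolding e by (intro norm_prod_diff) auto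
    also have "\<dots> \<le> (\<Sum>i\<in>J N. t ^ 4 * m N * (\<alpha> N i)\<^sup>2)"
    proof (intro sum_mono)
      fix i assume i: "i \<in> J N"
      have "norm (cos (t * \<alpha> N i) - exp (- ((t * \<alpha> N i)\<^sup>2) / 2)) \<le> (t * \<alpha> N i) ^ 4"
        using cos_minus_exp_bound[of "t * \<alpha> N i"] by simp
      also have "\<dots> = t ^ 4 * ((\<alpha> N i)\<^sup>2 * (\<alpha> N i)\<^sup>2)"
        by (simp add: power_mult_distrib flip: power_add)
      also have "\<dots> \<le> t ^ 4 * (m N * (\<alpha> N i)\<^sup>2)"
        by (intro mult_left_mono mult_right_mono small i) auto
      finally show "norm (cos (t * \<alpha> N i) - exp (- ((t * \<alpha> N i)\<^sup>2) / 2)) \<le> t ^ 4 * m N * (\<alpha> N i)\<^sup>2"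
        by (simp add: mult.assoc)
    qed
    also have "\<dots> = t ^ 4 * m N" by (simp add: N flip: sum_distrib_left)
    finally show ?thesis .
  qed
  have "(\<lambda>N. (\<Prod>i\<in>J N. cos (t * \<alpha> N i)) - exp (- (t\<^sup>2) / 2)) \<longlonglongrightarrow> 0"
  proof (rule Lim_null_comparison)
    show "\<forall>\<^sub>F N in sequentially. norm ((\<Prod>i\<in>J N. cos (t * \<alpha> N i)) - exp (- (t\<^sup>2) / 2)) \<le> t ^ 4 * m N"
      using norm1 by eventually_elim (rule bnd)
    show "(\<lambda>N. t ^ 4 * m N) \<longlonglongrightarrow> 0" using tendsto_mult_left[OF m, of "t ^ 4"] by simp
  qed
  then show ?thesis by (simp add: LIM_zero_iff)
qed

locale random_signs = prob_space Q for Q :: "'h measure" +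
  fixes \<epsilon> :: "'i \<Rightarrow> 'h \<Rightarrow> real" and I :: "'i set"
  assumes signs_indep: "indep_vars (\<lambda>_. borel) \<epsilon> I"
    and signs_AE: "\<And>i. i \<in> I \<Longrightarrow> AE \<eta> in Q. \<epsilon> i \<eta> \<in> {-1, 1}"
    and signs_half: "\<And>i. i \<in> I \<Longrightarrow> prob {\<eta> \<in> space Q. \<epsilon> i \<eta> = 1} = 1 / 2"
begin

lemma signs_measurable: "i \<in> I \<Longrightarrow> random_variable borel (\<epsilon> i)"
  using signs_indep by (auto simp: indep_vars_def)

lemma expectation_sign:
  assumes i: "i \<in> I"
  shows "expectation (\<epsilon> i) = 0"
proof -
  note [measurable] = signs_measurable[OF i]
  let ?A = "{\<eta> \<in> space Q. \<epsilon> i \<eta> = 1}"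
  have "expectation (\<epsilon> i) = expectation (\<lambda>\<eta>. 2 * indicator ?A \<eta> - 1)"
    using signs_AE[OF i] by (intro integral_cong_AE) (auto split: split_indicator)
  also have "\<dots> = 2 * prob ?A - 1"
    by (subst Bochner_Integration.integral_diff) (auto simp: prob_space emeasure_eq_measure)
  finally show ?thesis using signs_half[OF i] by simp
qed

lemma char_weighted_sign:
  assumes i: "i \<in> I"
  shows "char (distr Q borel (\<lambda>\<eta>. a * \<epsilon> i \<eta>)) t = complex_of_real (cos (t * a))"
proof -
  note [measurable] = signs_measurable[OF i]
  have [simp]: "integrable Q (\<epsilon> i)"
    using signs_AE[OF i] by (intro integrable_const_bound[where B = 1]) auto
  have "char (distr Q borel (\<lambda>\<eta>. a * \<epsilon> i \<eta>)) t = (CLINT \<eta>|Q. iexp (t * (a * \<epsilon> i \<eta>)))"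
    by (simp add: char_def integral_distr)
  also have "\<dots> = (CLINT \<eta>|Q. cos (t * a) + \<i> * sin (t * a) * complex_of_real (\<epsilon> i \<eta>))"
    using signs_AE[OF i]
    by (intro integral_cong_AE) (auto simp: exp_Euler simp flip: of_real_mult cos_of_real sin_of_real)
  also have "\<dots> = complex_of_real (cos (t * a)) + \<i> * sin (t * a) * complex_of_real (expectation (\<epsilon> i))"
    by (subst Bochner_Integration.integral_add) (auto simp: prob_space)
  finally show ?thesis by (simp add: expectation_sign[OF i])
qed

lemma char_weighted_signs:
  assumes "J \<subseteq> I"
  shows "char (distr Q borel (\<lambda>\<eta>. \<Sum>i\<in>J. a i * \<epsilon> i \<eta>)) t = complex_of_real (\<Prod>i\<in>J. cos (t * a i))"
proof -
  have "indep_vars (\<lambda>_. borel) \<epsilon> J"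
    using signs_indep assms by (rule indep_vars_subset)
  then have "indep_vars (\<lambda>_. borel) (\<lambda>i \<eta>. a i * \<epsilon> i \<eta>) J"
    by (rule indep_vars_compose2) auto
  then have "char (distr Q borel (\<lambda>\<eta>. \<Sum>i\<in>J. a i * \<epsilon> i \<eta>)) t
      = (\<Prod>i\<in>J. char (distr Q borel (\<lambda>\<eta>. a i * \<epsilon> i \<eta>)) t)"
    by (rule char_distr_sum)
  also have "\<dots> = complex_of_real (\<Prod>i\<in>J. cos (t * a i))"
    unfolding of_real_prod using assms by (intro prod.cong) (auto simp: char_weighted_sign)
  finally show ?thesis .
qed

lemma char_weighted_signs_reindex:
  assumes inj: "inj_on g J" and sub: "g ` J \<subseteq> I"
  shows "char (distr Q borel (\<lambda>\<eta>. \<Sum>j\<in>J. a j * \<epsilon> (g j) \<eta>)) t = complex_of_real (\<Prod>j\<in>J. cos (t * a j))"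
  using char_weighted_signs[OF sub, of "a \<circ> the_inv_into J g" t] inj
  by (simp add: sum.reindex prod.reindex the_inv_into_f_f cong: sum.cong prod.cong)

lemma expectation_affine_pair:
  assumes u: "u \<in> I" and v: "v \<in> I"
  shows "integrable Q (\<lambda>\<eta>. (a + b * \<epsilon> u \<eta>) * (a' + b' * \<epsilon> v \<eta>))"
    and "expectation (\<lambda>\<eta>. (a + b * \<epsilon> u \<eta>) * (a' + b' * \<epsilon> v \<eta>)) = a * a' + b * b' * of_bool (u = v)"
proof -
  note [measurable] = signs_measurable[OF u] signs_measurable[OF v]
  have iu[simp]: "integrable Q (\<epsilon> u)"
    using signs_AE[OF u] by (intro integrable_const_bound[where B = 1]) auto
  have iv[simp]: "integrable Q (\<epsilon> v)"
    using signs_AE[OF v] by (intro integrable_const_bound[where B = 1]) auto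
  have iuv[simp]: "integrable Q (\<lambda>\<eta>. \<epsilon> u \<eta> * \<epsilon> v \<eta>)"
    using signs_AE[OF u] signs_AE[OF v] by (intro integrable_const_bound[where B = 1]) auto
  have euv: "expectation (\<lambda>\<eta>. \<epsilon> u \<eta> * \<epsilon> v \<eta>) = of_bool (u = v)"
  proof (cases "u = v")
    case True
    have "expectation (\<lambda>\<eta>. \<epsilon> u \<eta> * \<epsilon> v \<eta>) = expectation (\<lambda>\<eta>. 1)"
      using signs_AE[OF u] True by (intro integral_cong_AE) auto
    then show ?thesis using True by (simp add: prob_space)
  next
    case False
    have "indep_vars (\<lambda>_. borel) \<epsilon> {u, v}"
      using u v by (intro indep_vars_subset[OF signs_indep]) auto
    then have "expectation (\<lambda>\<eta>. \<Prod>i\<in>{u, v}. \<epsilon> i \<eta>) = (\<Prod>i\<in>{u, v}. expectation (\<epsilon> i))"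
      by (intro indep_vars_lebesgue_integral) auto
    then show ?thesis using False expectation_sign[OF u] by simp
  qed
  have eq: "(\<lambda>\<eta>. (a + b * \<epsilon> u \<eta>) * (a' + b' * \<epsilon> v \<eta>))
      = (\<lambda>\<eta>. a * a' + a * b' * \<epsilon> v \<eta> + b * a' * \<epsilon> u \<eta> + b * b' * (\<epsilon> u \<eta> * \<epsilon> v \<eta>))"
    by (auto simp: algebra_simps)
  show "integrable Q (\<lambda>\<eta>. (a + b * \<epsilon> u \<eta>) * (a' + b' * \<epsilon> v \<eta>))"
    unfolding eq by simp
  show "expectation (\<lambda>\<eta>. (a + b * \<epsilon> u \<eta>) * (a' + b' * \<epsilon> v \<eta>)) = a * a' + b * b' * of_bool (u = v)"
    unfolding eq by (simp add: prob_space expectation_sign u v euv)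
qed

lemma expectation_prod_affine_pairs:
  assumes J: "finite J" and u: "\<And>j. j \<in> J \<Longrightarrow> u j \<in> I" and v: "\<And>j. j \<in> J \<Longrightarrow> v j \<in> I"
    and disj: "disjoint_family_on (\<lambda>j. {u j, v j}) J"
  shows "integrable Q (\<lambda>\<eta>. \<Prod>j\<in>J. (a j + b j * \<epsilon> (u j) \<eta>) * (a' j + b' j * \<epsilon> (v j) \<eta>))" (is ?int)
    and "expectation (\<lambda>\<eta>. \<Prod>j\<in>J. (a j + b j * \<epsilon> (u j) \<eta>) * (a' j + b' j * \<epsilon> (v j) \<eta>))
      = (\<Prod>j\<in>J. a j * a' j + b j * b' j * of_bool (u j = v j))" (is ?eq)
proof -
  have "indep_vars (\<lambda>j. PiM {u j, v j} (\<lambda>_. borel)) (\<lambda>j \<eta>. restrict (\<lambda>i. \<epsilon> i \<eta>) {u j, v j}) J"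
    using u v by (intro indep_vars_restrict[OF signs_indep _ disj]) auto
  then have "indep_vars (\<lambda>_. borel) (\<lambda>j \<eta>. (\<lambda>g. (a j + b j * g (u j)) * (a' j + b' j * g (v j)))
      (restrict (\<lambda>i. \<epsilon> i \<eta>) {u j, v j})) J"
    by (rule indep_vars_compose2) measurable
  then have ind: "indep_vars (\<lambda>_. borel) (\<lambda>j \<eta>. (a j + b j * \<epsilon> (u j) \<eta>) * (a' j + b' j * \<epsilon> (v j) \<eta>)) J"
    by simp
  show ?int
    using J ind by (rule indep_vars_integrable) (auto intro: expectation_affine_pair u v)
  show ?eq
    by (subst indep_vars_lebesgue_integral[OF J ind])
      (auto intro!: expectation_affine_pair prod.cong u v)
qed

lemma char_perturbation:
  assumes [measurable]: "random_variable borel X" "random_variable borel Y"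
    and int: "integrable Q (\<lambda>\<eta>. (X \<eta> - Y \<eta>)\<^sup>2)"
  shows "norm (char (distr Q borel X) t - char (distr Q borel Y) t)
    \<le> \<bar>t\<bar> * sqrt (expectation (\<lambda>\<eta>. (X \<eta> - Y \<eta>)\<^sup>2))"
proof -
  have int1: "integrable Q (\<lambda>\<eta>. \<bar>X \<eta> - Y \<eta>\<bar>)"
    using square_integrable_imp_integrable[OF _ int] by simp
  have iX: "integrable Q (\<lambda>\<eta>. iexp (t * X \<eta>))" and iY: "integrable Q (\<lambda>\<eta>. iexp (t * Y \<eta>))"
    by (auto intro!: integrable_const_bound[where B = 1] AE_I2)
  have pw: "norm (iexp (t * X \<eta>) - iexp (t * Y \<eta>)) \<le> \<bar>t\<bar> * \<bar>X \<eta> - Y \<eta>\<bar>" for \<eta>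
  proof -
    have "iexp (t * X \<eta>) - iexp (t * Y \<eta>) = iexp (t * Y \<eta>) * (iexp (t * (X \<eta> - Y \<eta>)) - 1)"
      by (simp add: algebra_simps flip: exp_add)
    then have "norm (iexp (t * X \<eta>) - iexp (t * Y \<eta>)) = norm (iexp (t * (X \<eta> - Y \<eta>)) - 1)"
      by (simp add: norm_mult)
    also have "\<dots> \<le> \<bar>t * (X \<eta> - Y \<eta>)\<bar>"
      using iexp_approx1[of "t * (X \<eta> - Y \<eta>)" 0] by simp
    finally show ?thesis by (simp add: abs_mult)
  qed
  have "char (distr Q borel X) t - char (distr Q borel Y) t = (CLINT \<eta>|Q. iexp (t * X \<eta>) - iexp (t * Y \<eta>))"
    unfolding Bochner_Integration.integral_diff[OF iX iY] by (simp add: char_def integral_distr)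
  also have "norm \<dots> \<le> expectation (\<lambda>\<eta>. norm (iexp (t * X \<eta>) - iexp (t * Y \<eta>)))"
    by (rule integral_norm_bound)
  also have "\<dots> \<le> expectation (\<lambda>\<eta>. \<bar>t\<bar> * \<bar>X \<eta> - Y \<eta>\<bar>)"
    using iX iY int1 by (intro integral_mono pw) auto
  also have "\<dots> = \<bar>t\<bar> * expectation (\<lambda>\<eta>. \<bar>X \<eta> - Y \<eta>\<bar>)"
    by simp
  also have "expectation (\<lambda>\<eta>. \<bar>X \<eta> - Y \<eta>\<bar>) \<le> sqrt (expectation (\<lambda>\<eta>. (X \<eta> - Y \<eta>)\<^sup>2))"
  proof (rule real_le_rsqrt)
    have "0 \<le> variance (\<lambda>\<eta>. \<bar>X \<eta> - Y \<eta>\<bar>)" by (rule variance_positive)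
    also have "\<dots> = expectation (\<lambda>\<eta>. (X \<eta> - Y \<eta>)\<^sup>2) - (expectation (\<lambda>\<eta>. \<bar>X \<eta> - Y \<eta>\<bar>))\<^sup>2"
      using int1 int by (subst variance_eq) auto
    finally show "(expectation (\<lambda>\<eta>. \<bar>X \<eta> - Y \<eta>\<bar>))\<^sup>2 \<le> expectation (\<lambda>\<eta>. (X \<eta> - Y \<eta>)\<^sup>2)" by simp
  qed
  finally show ?thesis by (simp add: mult_left_mono)
qed

end

section \<open>Collisions of two paths\<close>

locale step_kernel =
  fixes V :: "'a set" and nb :: "'a \<Rightarrow> 'a set" and D :: nat
  assumes D_pos: "D > 0"
    and nb_finite: "\<And>x. x \<in> V \<Longrightarrow> finite (nb x)"
    and nb_card: "\<And>x. x \<in> V \<Longrightarrow> card (nb x) = D"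
    and nb_V: "\<And>x y. x \<in> V \<Longrightarrow> y \<in> nb x \<Longrightarrow> y \<in> V"
begin

definition avg :: "('a \<Rightarrow> real) \<Rightarrow> 'a \<Rightarrow> real" where
  "avg f x = (\<Sum>y\<in>nb x. f y) / D"

primrec paths :: "nat \<Rightarrow> 'a \<Rightarrow> 'a list set" where
  "paths 0 x = {[]}"
| "paths (Suc n) x = (\<Union>y\<in>nb x. Cons y ` paths n y)"

definition path_mean :: "nat \<Rightarrow> 'a \<Rightarrow> ('a list \<Rightarrow> real) \<Rightarrow> real" where
  "path_mean n x F = (\<Sum>l\<in>paths n x. F l) / real D ^ n"

lemma avg_cong: "x \<in> V \<Longrightarrow> (\<And>y. y \<in> V \<Longrightarrow> f y = g y) \<Longrightarrow> avg f x = avg g x"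
  unfolding avg_def by (metis (mono_tags, lifting) nb_V sum.cong)

lemma avg_const: "x \<in> V \<Longrightarrow> avg (\<lambda>_. a) x = a"
  using D_pos by (simp add: avg_def nb_card)

lemma avg_add: "avg (\<lambda>y. f y + g y) x = avg f x + avg g x"
  by (simp add: avg_def sum.distrib add_divide_distrib)

lemma avg_mult: "avg (\<lambda>y. a * f y) x = a * avg f x"
  by (simp add: avg_def sum_distrib_left)

lemma avg_mono: "x \<in> V \<Longrightarrow> (\<And>y. y \<in> V \<Longrightarrow> f y \<le> g y) \<Longrightarrow> avg f x \<le> avg g x"
  unfolding avg_def by (intro divide_right_mono sum_mono) (auto intro: nb_V)

lemma avg_sum: "avg (\<lambda>y. \<Sum>i\<in>S. f i y) x = (\<Sum>i\<in>S. avg (f i) x)"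
  by (simp add: avg_def sum.swap[of _ S] sum_divide_distrib)

lemma paths_finite: "x \<in> V \<Longrightarrow> finite (paths n x)"
  by (induction n arbitrary: x) (auto simp: nb_finite nb_V)

lemma paths_length: "l \<in> paths n x \<Longrightarrow> length l = n"
  by (induction n arbitrary: x l) auto

lemma paths_nth: "x \<in> V \<Longrightarrow> l \<in> paths n x \<Longrightarrow> i < n \<Longrightarrow> l ! i \<in> V"
proof (induction n arbitrary: x l i)
  case (Suc n)
  then obtain y l' where "y \<in> nb x" "l' \<in> paths n y" "l = y # l'" by auto
  with Suc show ?case by (cases i) (auto dest: nb_V)
qed simp

lemma path_mean_0: "path_mean 0 x F = F []"
  by (simp add: path_mean_def)

lemma path_mean_Suc:
  assumes "x \<in> V"
  shows "path_mean (Suc n) x F = avg (\<lambda>y. path_mean n y (\<lambda>l. F (y # l))) x"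
proof -
  have "(\<Sum>l\<in>paths (Suc n) x. F l) = (\<Sum>y\<in>nb x. \<Sum>l\<in>Cons y ` paths n y. F l)"
    using assms by (auto intro!: sum.UNION_disjoint simp: nb_finite paths_finite nb_V)
  also have "\<dots> = (\<Sum>y\<in>nb x. \<Sum>l\<in>paths n y. F (y # l))"
    by (simp add: sum.reindex)
  finally show ?thesis by (simp add: path_mean_def avg_def flip: sum_divide_distrib)
qed

lemma path_mean_add: "path_mean n x (\<lambda>l. F l + F' l) = path_mean n x F + path_mean n x F'"
  by (simp add: path_mean_def sum.distrib add_divide_distrib)

lemma path_mean_diff: "path_mean n x (\<lambda>l. F l - F' l) = path_mean n x F - path_mean n x F'"
  by (simp add: path_mean_def sum_subtractf diff_divide_distrib)

lemma path_mean_mult: "path_mean n x (\<lambda>l. a * F l) = a * path_mean n x F"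
  by (simp add: path_mean_def sum_distrib_left)

lemma path_mean_const: "x \<in> V \<Longrightarrow> path_mean n x (\<lambda>_. a) = a"
  by (induction n arbitrary: x) (simp_all add: path_mean_0 path_mean_Suc avg_const cong: avg_cong)

lemma card_paths: "x \<in> V \<Longrightarrow> real (card (paths n x)) = real D ^ n"
  using path_mean_const[of x n 1] D_pos by (simp add: path_mean_def)

lemma path_mean_avg:
  assumes "x \<in> V" "z \<in> V"
  shows "path_mean n x (\<lambda>l. avg (f l) z) = avg (\<lambda>y. path_mean n x (\<lambda>l. f l y)) z"
  by (simp add: path_mean_def avg_def sum_divide_distrib sum.swap[of _ "paths n x"] mult.commute)

lemma path_mean_sum_nth:
  "x \<in> V \<Longrightarrow> path_mean n x (\<lambda>l. \<Sum>i<n. f i (l ! i)) = (\<Sum>i<n. (avg ^^ Suc i) (f i) x)"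
proof (induction n arbitrary: x f)
  case (Suc n)
  have "path_mean (Suc n) x (\<lambda>l. \<Sum>i<Suc n. f i (l ! i))
      = avg (\<lambda>y. path_mean n y (\<lambda>l. f 0 y + (\<Sum>i<n. f (Suc i) (l ! i)))) x"
    by (simp add: path_mean_Suc[OF Suc.prems] sum.lessThan_Suc_shift del: sum.lessThan_Suc)
  also have "\<dots> = avg (\<lambda>y. f 0 y + (\<Sum>i<n. (avg ^^ Suc i) (f (Suc i)) y)) x"
    by (intro avg_cong Suc.prems) (simp add: path_mean_add path_mean_const Suc.IH[where f = "\<lambda>i. f (Suc i)"])
  also have "\<dots> = (\<Sum>i<Suc n. (avg ^^ Suc i) (f i) x)"
    by (simp add: avg_add avg_sum sum.lessThan_Suc_shift del: sum.lessThan_Suc)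
  finally show ?case .
qed (simp add: path_mean_0)

definition collision_gf :: "real \<Rightarrow> nat \<Rightarrow> 'a \<Rightarrow> 'a \<Rightarrow> real" where
  "collision_gf \<rho> n x y =
    path_mean n x (\<lambda>l. path_mean n y (\<lambda>l'. \<Prod>i<n. 1 + \<rho> * of_bool (l ! i = l' ! i)))"

definition collisions :: "nat \<Rightarrow> 'a \<Rightarrow> 'a \<Rightarrow> real" where
  "collisions n x y = path_mean n x (\<lambda>l. path_mean n y (\<lambda>l'. \<Sum>i<n. of_bool (l ! i = l' ! i)))"

lemma collision_gf_Suc:
  assumes x: "x \<in> V" and y: "y \<in> V"
  shows "collision_gf \<rho> (Suc n) x y
    = avg (\<lambda>u. avg (\<lambda>v. (1 + \<rho> * of_bool (u = v)) * collision_gf \<rho> n u v) y) x"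
  unfolding collision_gf_def path_mean_Suc[OF x] path_mean_Suc[OF y]
  by (intro avg_cong x) (simp add: path_mean_avg y prod.lessThan_Suc_shift path_mean_mult
      del: prod.lessThan_Suc)

lemma collisions_Suc:
  assumes x: "x \<in> V" and y: "y \<in> V"
  shows "collisions (Suc n) x y
    = avg (\<lambda>u. avg (\<lambda>v. of_bool (u = v) + collisions n u v) y) x"
  unfolding collisions_def path_mean_Suc[OF x] path_mean_Suc[OF y]
  by (intro avg_cong x) (simp add: path_mean_avg y sum.lessThan_Suc_shift path_mean_add path_mean_const
      del: sum.lessThan_Suc cong: avg_cong)

text \<open>After a collision the two paths restart from a common point, so each collision costs at most a
  further factor \<open>\<Gamma>\<close>; the value of \<open>\<Gamma>\<close> is the fixed point of \<open>\<Gamma> = 1 + \<rho> * \<Gamma> * R\<close>.\<close>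

lemma collision_gf_bound:
  assumes R: "\<And>k x. k \<le> N \<Longrightarrow> x \<in> V \<Longrightarrow> collisions k x x \<le> R"
    and \<rho>: "0 \<le> \<rho>" "\<rho> * R < 1" and n: "n \<le> N" and x: "x \<in> V" and y: "y \<in> V"
  shows "collision_gf \<rho> n x y \<le> 1 + \<rho> * collisions n x y / (1 - \<rho> * R)"
  using n x y
proof (induction n arbitrary: x y)
  case 0
  then show ?case by (simp add: collision_gf_def collisions_def path_mean_0)
next
  case (Suc n)
  define \<Gamma> where "\<Gamma> = 1 / (1 - \<rho> * R)"
  have \<Gamma>: "\<Gamma> \<ge> 0" "1 + \<rho> * \<Gamma> * R = \<Gamma>" using \<rho> by (auto simp: \<Gamma>_def field_simps)
  have diag: "collision_gf \<rho> n u u \<le> \<Gamma>" if u: "u \<in> V" for u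
  proof -
    have "collision_gf \<rho> n u u \<le> 1 + \<rho> * \<Gamma> * collisions n u u"
      using Suc.IH[of u u] Suc.prems u by (simp add: \<Gamma>_def)
    also have "\<dots> \<le> 1 + \<rho> * \<Gamma> * R"
      using R[of n u] Suc.prems u \<rho> \<Gamma> by (intro add_left_mono mult_left_mono) auto
    finally show ?thesis using \<Gamma> by simp
  qed
  have "collision_gf \<rho> (Suc n) x y
      = avg (\<lambda>u. avg (\<lambda>v. collision_gf \<rho> n u v + \<rho> * (of_bool (u = v) * collision_gf \<rho> n u u)) y) x"
    unfolding collision_gf_Suc[OF Suc.prems(2,3)]
    by (intro avg_cong Suc.prems) (auto simp: algebra_simps)
  also have "\<dots> \<le> avg (\<lambda>u. avg (\<lambda>v. (1 + \<rho> * \<Gamma> * collisions n u v) + \<rho> * (of_bool (u = v) * \<Gamma>)) y) x"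
  proof (intro avg_mono Suc.prems add_mono)
    fix u v assume "u \<in> V" "v \<in> V"
    then show "collision_gf \<rho> n u v \<le> 1 + \<rho> * \<Gamma> * collisions n u v"
      using Suc.IH[of u v] Suc.prems by (simp add: \<Gamma>_def)
    show "\<rho> * (of_bool (u = v) * collision_gf \<rho> n u u) \<le> \<rho> * (of_bool (u = v) * \<Gamma>)"
      using diag[OF \<open>u \<in> V\<close>] \<rho> by (intro mult_left_mono) auto
  qed
  also have "\<dots> = avg (\<lambda>u. avg (\<lambda>v. 1 + \<rho> * \<Gamma> * (of_bool (u = v) + collisions n u v)) y) x"
    by (intro avg_cong Suc.prems) (simp add: algebra_simps)
  also have "\<dots> = 1 + \<rho> * \<Gamma> * collisions (Suc n) x y"
    using Suc.prems by (simp add: avg_add[where f = "\<lambda>_. 1"] avg_mult avg_const collisions_Suc)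
  finally show ?case by (simp add: \<Gamma>_def)
qed

end

locale explicit_kernel = step_kernel V nb D for V :: "'a set" and nb D +
  fixes K :: "nat \<Rightarrow> 'k set" and w :: "nat \<Rightarrow> 'k \<Rightarrow> real" and pos :: "nat \<Rightarrow> 'a \<Rightarrow> 'k \<Rightarrow> 'a"
  assumes K_finite: "finite (K n)"
    and w_nonneg: "0 \<le> w n k"
    and pos_V: "x \<in> V \<Longrightarrow> k \<in> K n \<Longrightarrow> pos n x k \<in> V"
    and pos_inj: "x \<in> V \<Longrightarrow> inj_on (pos n x) (K n)"
    and avg_funpow: "x \<in> V \<Longrightarrow> (avg ^^ n) f x = (\<Sum>k\<in>K n. w n k * f (pos n x k))"
begin

definition overlap :: "nat \<Rightarrow> real" where
  "overlap N = (\<Sum>i<N. \<Sum>k\<in>K (Suc i). (w (Suc i) k)\<^sup>2)"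

lemma overlap_mono: "m \<le> n \<Longrightarrow> overlap m \<le> overlap n"
  unfolding overlap_def by (intro sum_mono2 sum_nonneg) auto

lemma w_le_1:
  assumes "x \<in> V" "k \<in> K n"
  shows "w n k \<le> 1"
proof -
  have "(avg ^^ n) (\<lambda>_. 1) x = 1"
    using assms(1) by (induction n arbitrary: x) (auto simp: avg_const cong: avg_cong)
  then have "(\<Sum>k\<in>K n. w n k) = 1" by (simp add: avg_funpow[OF assms(1)])
  then show ?thesis
    using member_le_sum[OF assms(2) _ K_finite, of "w n"] w_nonneg by auto
qed

lemma collisions_diag:
  assumes x: "x \<in> V"
  shows "collisions N x x = overlap N"
proof -
  have "collisions N x x = path_mean N x (\<lambda>l. \<Sum>i<N. (avg ^^ Suc i) (\<lambda>v. of_bool (l ! i = v)) x)"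
    unfolding collisions_def by (simp only: path_mean_sum_nth[OF x, where f = "\<lambda>i v. of_bool (_ i = v)"])
  also have "\<dots> = (\<Sum>i<N. (avg ^^ Suc i) (\<lambda>u. (avg ^^ Suc i) (\<lambda>v. of_bool (u = v)) x) x)"
    by (rule path_mean_sum_nth[OF x])
  also have "\<dots> = overlap N"
    unfolding overlap_def
  proof (intro sum.cong refl)
    fix i
    let ?n = "Suc i"
    have "(avg ^^ ?n) (\<lambda>u. (avg ^^ ?n) (\<lambda>v. of_bool (u = v)) x) x
      = (\<Sum>k\<in>K ?n. w ?n k * (\<Sum>j\<in>K ?n. w ?n j * of_bool (pos ?n x k = pos ?n x j)))"
      by (simp only: avg_funpow[OF x])
    also have "\<dots> = (\<Sum>k\<in>K ?n. w ?n k * (\<Sum>j\<in>K ?n. if k = j then w ?n j else 0))"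
      using pos_inj[OF x, of ?n] by (intro sum.cong refl arg_cong2[of _ _ _ _ "(*)"]) (auto simp: inj_on_def)
    also have "\<dots> = (\<Sum>k\<in>K ?n. (w ?n k)\<^sup>2)"
      by (intro sum.cong refl) (simp add: K_finite power2_eq_square)
    finally show "(avg ^^ ?n) (\<lambda>u. (avg ^^ ?n) (\<lambda>v. of_bool (u = v)) x) x = (\<Sum>k\<in>K ?n. (w ?n k)\<^sup>2)" .
  qed
  finally show ?thesis .
qed

lemma collision_gf_remainder:
  assumes x: "x \<in> V" and \<rho>: "0 \<le> \<rho>" "\<rho> * overlap N < 1"
  shows "collision_gf \<rho> N x x - 1 - \<rho> * overlap N \<le> (\<rho> * overlap N)\<^sup>2 / (1 - \<rho> * overlap N)"
proof -
  have "collision_gf \<rho> N x x \<le> 1 + \<rho> * collisions N x x / (1 - \<rho> * overlap N)"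
    by (rule collision_gf_bound[OF _ \<rho> order_refl x x]) (simp add: collisions_diag overlap_mono)
  then show ?thesis using \<rho> by (simp add: collisions_diag[OF x] field_simps power2_eq_square)
qed

end

section \<open>Directed polymers in a random sign environment\<close>

locale polymer =
  explicit_kernel V nb D K w pos + random_signs Q "\<lambda>(n, x) \<eta>. h \<eta> n x" "UNIV \<times> V"
  for V :: "'a set" and nb :: "'a \<Rightarrow> 'a set" and D :: nat
    and K :: "nat \<Rightarrow> 'k set" and w :: "nat \<Rightarrow> 'k \<Rightarrow> real" and pos :: "nat \<Rightarrow> 'a \<Rightarrow> 'k \<Rightarrow> 'a"
    and Q :: "'h measure" and h :: "'h \<Rightarrow> nat \<Rightarrow> 'a \<Rightarrow> real" +
  fixes x\<^sub>0 :: 'a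
  assumes x0: "x\<^sub>0 \<in> V"
begin

definition weight :: "real \<Rightarrow> nat \<Rightarrow> 'a list \<Rightarrow> 'h \<Rightarrow> real" where
  "weight s N l \<eta> = (\<Prod>i<N. 1 + s * h \<eta> (Suc i) (l ! i))"

definition energy :: "nat \<Rightarrow> 'a list \<Rightarrow> 'h \<Rightarrow> real" where
  "energy N l \<eta> = (\<Sum>i<N. h \<eta> (Suc i) (l ! i))"

definition overlap_paths :: "nat \<Rightarrow> 'a list \<Rightarrow> 'a list \<Rightarrow> real" where
  "overlap_paths N l l' = (\<Sum>i<N. of_bool (l ! i = l' ! i))"

lemma has_expectation_sites:
  assumes "x \<in> V" "y \<in> V"
  shows "has_bochner_integral Q (\<lambda>\<eta>. h \<eta> m x * h \<eta> n y) (of_bool (m = n \<and> x = y))"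
    and "has_bochner_integral Q (\<lambda>\<eta>. h \<eta> m x) 0"
  using expectation_affine_pair[of "(m, x)" "(n, y)" 0 1 0 1] expectation_affine_pair[of "(m, x)" "(n, y)" 0 1 1 0] assms
  by (auto simp: has_bochner_integral_iff)

lemma has_expectation_paths:
  assumes l: "l \<in> paths N x\<^sub>0" and l': "l' \<in> paths N x\<^sub>0"
  shows "has_bochner_integral Q
    (\<lambda>\<eta>. \<Prod>i<N. (a i + b i * h \<eta> (Suc i) (l ! i)) * (a' i + b' i * h \<eta> (Suc i) (l' ! i)))
    (\<Prod>i<N. a i * a' i + b i * b' i * of_bool (l ! i = l' ! i))"
  using expectation_prod_affine_pairs[of "{..<N}" "\<lambda>i. (Suc i, l ! i)" "\<lambda>i. (Suc i, l' ! i)" a b a' b']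
    paths_nth[OF x0 l] paths_nth[OF x0 l']
  by (auto simp: has_bochner_integral_iff disjoint_family_on_def)

lemma weight_weight:
  assumes l: "l \<in> paths N x\<^sub>0" and l': "l' \<in> paths N x\<^sub>0"
  shows "has_bochner_integral Q (\<lambda>\<eta>. weight s N l \<eta> * weight s N l' \<eta>)
    (\<Prod>i<N. 1 + s\<^sup>2 * of_bool (l ! i = l' ! i))"
  using has_expectation_paths[OF l l', of "\<lambda>_. 1" "\<lambda>_. s" "\<lambda>_. 1" "\<lambda>_. s"]
  by (simp add: weight_def power2_eq_square flip: prod.distrib)

lemma weight_mean:
  assumes l: "l \<in> paths N x\<^sub>0"
  shows "has_bochner_integral Q (weight s N l) 1"
  using has_expectation_paths[OF l l, of "\<lambda>_. 1" "\<lambda>_. s" "\<lambda>_. 1" "\<lambda>_. 0"]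
  by (simp add: weight_def[abs_def])

lemma energy_mean:
  assumes l: "l \<in> paths N x\<^sub>0"
  shows "has_bochner_integral Q (energy N l) 0"
proof -
  have "has_bochner_integral Q (\<lambda>\<eta>. \<Sum>i<N. h \<eta> (Suc i) (l ! i)) (\<Sum>i<N. 0)"
    by (intro has_bochner_integral_sum has_expectation_sites(2)[OF _ x0] paths_nth[OF x0 l]) auto
  then show ?thesis by (simp add: energy_def[abs_def])
qed

lemma energy_energy:
  assumes l: "l \<in> paths N x\<^sub>0" and l': "l' \<in> paths N x\<^sub>0"
  shows "has_bochner_integral Q (\<lambda>\<eta>. energy N l \<eta> * energy N l' \<eta>) (overlap_paths N l l')"
proof -
  have "has_bochner_integral Q (\<lambda>\<eta>. \<Sum>i<N. \<Sum>j<N. h \<eta> (Suc i) (l ! i) * h \<eta> (Suc j) (l' ! j))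
      (\<Sum>i<N. \<Sum>j<N. of_bool (Suc i = Suc j \<and> l ! i = l' ! j))"
    by (intro has_bochner_integral_sum has_expectation_sites(1) paths_nth[OF x0 l] paths_nth[OF x0 l']) auto
  also have "(\<Sum>i<N. \<Sum>j<N. of_bool (Suc i = Suc j \<and> l ! i = l' ! j))
      = (\<Sum>i<N. \<Sum>j<N. if i = j then of_bool (l ! i = l' ! j) else (0::real))"
    by (intro sum.cong) auto
  finally show ?thesis by (simp add: energy_def overlap_paths_def sum_product)
qed

lemma weight_energy:
  assumes l: "l \<in> paths N x\<^sub>0" and l': "l' \<in> paths N x\<^sub>0"
  shows "has_bochner_integral Q (\<lambda>\<eta>. weight s N l \<eta> * energy N l' \<eta>) (s * overlap_paths N l l')"
proof -
  have "has_bochner_integral Q (\<lambda>\<eta>. weight s N l \<eta> * h \<eta> (Suc m) (l' ! m)) (s * of_bool (l ! m = l' ! m))"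
    if m: "m < N" for m
  proof -
    let ?a = "\<lambda>i. if i = m then 0 else 1 :: real" and ?b = "\<lambda>i. if i = m then 1 else 0 :: real"
    have 1: "weight s N l \<eta> * h \<eta> (Suc m) (l' ! m)
      = (\<Prod>i<N. (1 + s * h \<eta> (Suc i) (l ! i)) * (?a i + ?b i * h \<eta> (Suc i) (l' ! i)))" for \<eta>
    proof -
      have "(\<Prod>i<N. ?a i + ?b i * h \<eta> (Suc i) (l' ! i)) = (\<Prod>i<N. if i = m then h \<eta> (Suc i) (l' ! i) else 1)"
        by (intro prod.cong) auto
      then show ?thesis using m by (simp add: weight_def prod.distrib)
    qed
    have 2: "(\<Prod>i<N. 1 * ?a i + s * ?b i * of_bool (l ! i = l' ! i)) = s * of_bool (l ! m = l' ! m)"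
    proof -
      have "(\<Prod>i<N. 1 * ?a i + s * ?b i * of_bool (l ! i = l' ! i))
          = (\<Prod>i<N. if i = m then s * of_bool (l ! i = l' ! i) else 1)"
        by (intro prod.cong) auto
      then show ?thesis using m by simp
    qed
    show ?thesis
      unfolding 1 2[symmetric] by (rule has_expectation_paths[OF l l'])
  qed
  then have "has_bochner_integral Q (\<lambda>\<eta>. \<Sum>m<N. weight s N l \<eta> * h \<eta> (Suc m) (l' ! m))
      (\<Sum>m<N. s * of_bool (l ! m = l' ! m))"
    by (intro has_bochner_integral_sum) auto
  then show ?thesis by (simp only: energy_def overlap_paths_def sum_distrib_left)
qed

definition remainder :: "real \<Rightarrow> nat \<Rightarrow> 'a list \<Rightarrow> 'h \<Rightarrow> real" where
  "remainder s N l \<eta> = weight s N l \<eta> - 1 - s * energy N l \<eta>"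

lemma overlap_paths_commute: "overlap_paths N l l' = overlap_paths N l' l"
  by (simp add: overlap_paths_def eq_commute)

lemma remainder_remainder:
  assumes l: "l \<in> paths N x\<^sub>0" and l': "l' \<in> paths N x\<^sub>0"
  shows "has_bochner_integral Q (\<lambda>\<eta>. remainder s N l \<eta> * remainder s N l' \<eta>)
    ((\<Prod>i<N. 1 + s\<^sup>2 * of_bool (l ! i = l' ! i)) - 1 - s\<^sup>2 * overlap_paths N l l')"
proof -
  have one: "has_bochner_integral Q (\<lambda>\<eta>. 1 :: real) 1"
    by (simp add: has_bochner_integral_iff prob_space)
  have "has_bochner_integral Q
    (\<lambda>\<eta>. (weight s N l \<eta> * weight s N l' \<eta> - weight s N l \<eta> - weight s N l' \<eta> + 1
      + s\<^sup>2 * (energy N l \<eta> * energy N l' \<eta>) + s * energy N l \<eta> + s * energy N l' \<eta>)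
      - (s * (weight s N l \<eta> * energy N l' \<eta>) + s * (weight s N l' \<eta> * energy N l \<eta>)))
    (((\<Prod>i<N. 1 + s\<^sup>2 * of_bool (l ! i = l' ! i)) - 1 - 1 + 1
      + s\<^sup>2 * overlap_paths N l l' + s * 0 + s * 0)
      - (s * (s * overlap_paths N l l') + s * (s * overlap_paths N l' l)))"
    by (intro has_bochner_integral_add has_bochner_integral_diff has_bochner_integral_mult_right one
        weight_weight weight_mean weight_energy energy_energy energy_mean l l')
  moreover have "(\<lambda>\<eta>. (weight s N l \<eta> * weight s N l' \<eta> - weight s N l \<eta> - weight s N l' \<eta> + 1
      + s\<^sup>2 * (energy N l \<eta> * energy N l' \<eta>) + s * energy N l \<eta> + s * energy N l' \<eta>)
      - (s * (weight s N l \<eta> * energy N l' \<eta>) + s * (weight s N l' \<eta> * energy N l \<eta>)))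
      = (\<lambda>\<eta>. remainder s N l \<eta> * remainder s N l' \<eta>)"
    by (rule ext) (simp add: remainder_def algebra_simps power2_eq_square)
  ultimately show ?thesis
    by (simp add: overlap_paths_commute[of N l' l] power2_eq_square algebra_simps)
qed

lemma has_expectation_path_mean:
  assumes "\<And>l. l \<in> paths N x\<^sub>0 \<Longrightarrow> has_bochner_integral Q (F l) (e l)"
  shows "has_bochner_integral Q (\<lambda>\<eta>. path_mean N x\<^sub>0 (\<lambda>l. F l \<eta>)) (path_mean N x\<^sub>0 e)"
  unfolding path_mean_def using assms D_pos
  by (intro has_bochner_integral_divide has_bochner_integral_sum) auto

lemma remainder_second_moment:
  "has_bochner_integral Q (\<lambda>\<eta>. (path_mean N x\<^sub>0 (\<lambda>l. remainder s N l \<eta>))\<^sup>2)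
    (collision_gf (s\<^sup>2) N x\<^sub>0 x\<^sub>0 - 1 - s\<^sup>2 * overlap N)"
proof -
  have "(path_mean N x\<^sub>0 (\<lambda>l. remainder s N l \<eta>))\<^sup>2
      = path_mean N x\<^sub>0 (\<lambda>l. path_mean N x\<^sub>0 (\<lambda>l'. remainder s N l \<eta> * remainder s N l' \<eta>))" for \<eta>
  proof -
    let ?m = "path_mean N x\<^sub>0 (\<lambda>l. remainder s N l \<eta>)"
    have "path_mean N x\<^sub>0 (\<lambda>l. path_mean N x\<^sub>0 (\<lambda>l'. remainder s N l \<eta> * remainder s N l' \<eta>))
        = path_mean N x\<^sub>0 (\<lambda>l. ?m * remainder s N l \<eta>)"
      by (simp only: path_mean_mult mult.commute[of ?m])
    then show ?thesis by (simp only: path_mean_mult power2_eq_square)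
  qed
  moreover have "path_mean N x\<^sub>0 (\<lambda>l. path_mean N x\<^sub>0
      (\<lambda>l'. (\<Prod>i<N. 1 + s\<^sup>2 * of_bool (l ! i = l' ! i)) - 1 - s\<^sup>2 * overlap_paths N l l'))
    = collision_gf (s\<^sup>2) N x\<^sub>0 x\<^sub>0 - 1 - s\<^sup>2 * overlap N"
    using collisions_diag[OF x0, of N]
    by (simp add: path_mean_diff path_mean_const[OF x0] path_mean_mult collision_gf_def collisions_def
        overlap_paths_def)
  moreover have "has_bochner_integral Q
      (\<lambda>\<eta>. path_mean N x\<^sub>0 (\<lambda>l. path_mean N x\<^sub>0 (\<lambda>l'. remainder s N l \<eta> * remainder s N l' \<eta>)))
      (path_mean N x\<^sub>0 (\<lambda>l. path_mean N x\<^sub>0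
        (\<lambda>l'. (\<Prod>i<N. 1 + s\<^sup>2 * of_bool (l ! i = l' ! i)) - 1 - s\<^sup>2 * overlap_paths N l l')))"
    by (intro has_expectation_path_mean remainder_remainder)
  ultimately show ?thesis by simp
qed

lemma path_mean_energy:
  "path_mean N x\<^sub>0 (\<lambda>l. energy N l \<eta>)
    = (\<Sum>(i, k)\<in>(SIGMA i:{..<N}. K (Suc i)). w (Suc i) k * h \<eta> (Suc i) (pos (Suc i) x\<^sub>0 k))"
proof -
  have "path_mean N x\<^sub>0 (\<lambda>l. energy N l \<eta>) = (\<Sum>i<N. (avg ^^ Suc i) (h \<eta> (Suc i)) x\<^sub>0)"
    unfolding energy_def by (rule path_mean_sum_nth[OF x0])
  also have "\<dots> = (\<Sum>i<N. \<Sum>k\<in>K (Suc i). w (Suc i) k * h \<eta> (Suc i) (pos (Suc i) x\<^sub>0 k))"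
    by (simp only: avg_funpow[OF x0])
  finally show ?thesis by (simp add: sum.Sigma K_finite)
qed

definition partition_function :: "real \<Rightarrow> nat \<Rightarrow> 'h \<Rightarrow> real" where
  "partition_function s N \<eta> = path_mean N x\<^sub>0 (\<lambda>l. weight s N l \<eta>)"

lemma path_mean_remainder:
  "path_mean N x\<^sub>0 (\<lambda>l. remainder s N l \<eta>)
    = partition_function s N \<eta> - 1 - s * path_mean N x\<^sub>0 (\<lambda>l. energy N l \<eta>)"
  by (simp add: remainder_def partition_function_def path_mean_diff path_mean_mult path_mean_const[OF x0])

lemma partition_function_measurable [measurable]:
  "partition_function s N \<in> borel_measurable Q"
proof -
  have "has_bochner_integral Q (partition_function s N) (path_mean N x\<^sub>0 (\<lambda>_. 1))"
    unfolding partition_function_def[abs_def] by (intro has_expectation_path_mean weight_mean)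
  then show ?thesis by (auto simp: has_bochner_integral_iff)
qed

lemma energy_measurable [measurable]:
  "(\<lambda>\<eta>. path_mean N x\<^sub>0 (\<lambda>l. energy N l \<eta>)) \<in> borel_measurable Q"
proof -
  have "has_bochner_integral Q (\<lambda>\<eta>. path_mean N x\<^sub>0 (\<lambda>l. energy N l \<eta>)) (path_mean N x\<^sub>0 (\<lambda>_. 0))"
    by (intro has_expectation_path_mean energy_mean)
  then show ?thesis by (auto simp: has_bochner_integral_iff)
qed

lemma char_first_order:
  assumes R: "filterlim overlap at_top sequentially"
  shows "(\<lambda>N. char (distr Q borel (\<lambda>\<eta>. path_mean N x\<^sub>0 (\<lambda>l. energy N l \<eta>) / sqrt (overlap N))) t)
    \<longlonglongrightarrow> char std_normal_distribution t"
proof -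
  let ?J = "\<lambda>N. SIGMA i:{..<N}. K (Suc i)"
  let ?\<alpha> = "\<lambda>N (i, k). w (Suc i) k / sqrt (overlap N)"
  let ?g = "\<lambda>(i, k). (Suc i, pos (Suc i) x\<^sub>0 k)"
  have char: "char (distr Q borel (\<lambda>\<eta>. path_mean N x\<^sub>0 (\<lambda>l. energy N l \<eta>) / sqrt (overlap N))) t
      = complex_of_real (\<Prod>j\<in>?J N. cos (t * ?\<alpha> N j))" for N
  proof -
    have "path_mean N x\<^sub>0 (\<lambda>l. energy N l \<eta>) / sqrt (overlap N)
        = (\<Sum>j\<in>?J N. ?\<alpha> N j * (case ?g j of (n, x) \<Rightarrow> h \<eta> n x))" for \<eta>
      unfolding path_mean_energy sum_divide_distrib by (intro sum.cong) auto
    moreover have "inj_on ?g (?J N)"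
      using pos_inj[OF x0] by (auto simp: inj_on_def)
    moreover have "?g ` ?J N \<subseteq> UNIV \<times> V"
      using pos_V[OF x0] by auto
    ultimately show ?thesis
      using char_weighted_signs_reindex[of ?g "?J N" "?\<alpha> N" t] by (simp add: case_prod_unfold)
  qed
  have ov: "overlap N \<ge> 0" for N
    by (auto simp: overlap_def intro!: sum_nonneg)
  have "(\<lambda>N. \<Prod>j\<in>?J N. cos (t * ?\<alpha> N j)) \<longlonglongrightarrow> exp (- (t\<^sup>2) / 2)"
  proof (rule prod_cos_tendsto_gaussian)
    show "finite (?J N)" for N using K_finite by auto
    show "\<forall>\<^sub>F N in sequentially. (\<Sum>j\<in>?J N. (?\<alpha> N j)\<^sup>2) = 1"
      using filterlim_at_top_dense[THEN iffD1, OF R, rule_format, of 0]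
    proof eventually_elim
      case (elim N)
      have "(\<Sum>j\<in>?J N. (?\<alpha> N j)\<^sup>2) = (\<Sum>(i, k)\<in>?J N. (w (Suc i) k)\<^sup>2) / overlap N"
        unfolding sum_divide_distrib using ov[of N]
        by (intro sum.cong) (auto simp: power_divide)
      also have "(\<Sum>(i, k)\<in>?J N. (w (Suc i) k)\<^sup>2) = overlap N"
        by (simp add: overlap_def sum.Sigma K_finite)
      finally show ?case using elim by simp
    qed
    show "(?\<alpha> N j)\<^sup>2 \<le> 1 / overlap N" if "j \<in> ?J N" for N j
    proof -
      obtain i k where j: "j = (i, k)" "k \<in> K (Suc i)" using \<open>j \<in> ?J N\<close> by auto
      have "(w (Suc i) k)\<^sup>2 \<le> 1"
        using w_le_1[OF x0 j(2)] w_nonneg by (intro power_le_one) auto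
      then show ?thesis using ov[of N] j by (auto simp: power_divide intro: divide_right_mono)
    qed
    show "(\<lambda>N. 1 / overlap N) \<longlonglongrightarrow> 0"
      using tendsto_inverse_0_at_top[OF R] by (simp add: inverse_eq_divide)
  qed
  then show ?thesis
    unfolding char char_std_normal_distribution by (rule tendsto_of_real)
qed

lemma partition_function_clt:
  fixes c :: "nat \<Rightarrow> real"
  assumes R: "filterlim overlap at_top sequentially"
    and c_pos: "\<And>N. c N > 0"
    and cR: "(\<lambda>N. (c N)\<^sup>2 * overlap N) \<longlonglongrightarrow> 0"
  shows "weak_conv_m (\<lambda>N. distr Q borel
      (\<lambda>\<eta>. 1 / (c N * sqrt (overlap N)) * (partition_function (c N) N \<eta> - 1))) std_normal_distribution"
proof (rule levy_continuity)
  let ?X = "\<lambda>N \<eta>. 1 / (c N * sqrt (overlap N)) * (partition_function (c N) N \<eta> - 1)"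
  let ?Y = "\<lambda>N \<eta>. path_mean N x\<^sub>0 (\<lambda>l. energy N l \<eta>) / sqrt (overlap N)"
  let ?r = "\<lambda>N. (c N)\<^sup>2 * overlap N"
  show "real_distribution (distr Q borel (?X N))" for N
    by (rule real_distribution_distr) measurable
  show "real_distribution std_normal_distribution"
    by (rule real_dist_normal_dist)
  fix t :: real
  have "(\<lambda>N. char (distr Q borel (?X N)) t - char (distr Q borel (?Y N)) t) \<longlonglongrightarrow> 0"
  proof (rule Lim_null_comparison)
    have "\<forall>\<^sub>F N in sequentially. ?r N < 1"
      using cR by (rule order_tendstoD) simp
    moreover have "\<forall>\<^sub>F N in sequentially. overlap N > 0"
      using filterlim_at_top_dense[THEN iffD1, OF R] by blast
    ultimately show "\<forall>\<^sub>F N in sequentially.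
        norm (char (distr Q borel (?X N)) t - char (distr Q borel (?Y N)) t) \<le> \<bar>t\<bar> * sqrt (?r N / (1 - ?r N))"
    proof eventually_elim
      case (elim N)
      have diff: "(?X N \<eta> - ?Y N \<eta>)\<^sup>2 = (path_mean N x\<^sub>0 (\<lambda>l. remainder (c N) N l \<eta>))\<^sup>2 / ?r N" for \<eta>
      proof -
        have "?X N \<eta> - ?Y N \<eta> = path_mean N x\<^sub>0 (\<lambda>l. remainder (c N) N l \<eta>) / (c N * sqrt (overlap N))"
          using c_pos[of N] elim by (simp add: path_mean_remainder diff_divide_distrib)
        then show ?thesis using elim by (simp add: power_divide power_mult_distrib)
      qed
      have hb: "has_bochner_integral Q (\<lambda>\<eta>. (?X N \<eta> - ?Y N \<eta>)\<^sup>2)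
          ((collision_gf ((c N)\<^sup>2) N x\<^sub>0 x\<^sub>0 - 1 - ?r N) / ?r N)"
        unfolding diff by (intro has_bochner_integral_divide remainder_second_moment)
      have "norm (char (distr Q borel (?X N)) t - char (distr Q borel (?Y N)) t)
          \<le> \<bar>t\<bar> * sqrt (expectation (\<lambda>\<eta>. (?X N \<eta> - ?Y N \<eta>)\<^sup>2))"
        using hb by (intro char_perturbation) (auto simp: has_bochner_integral_iff)
      also have "expectation (\<lambda>\<eta>. (?X N \<eta> - ?Y N \<eta>)\<^sup>2) = (collision_gf ((c N)\<^sup>2) N x\<^sub>0 x\<^sub>0 - 1 - ?r N) / ?r N"
        using hb by (simp add: has_bochner_integral_iff)
      also have "\<bar>t\<bar> * sqrt \<dots> \<le> \<bar>t\<bar> * sqrt (?r N / (1 - ?r N))"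
      proof (intro mult_left_mono real_sqrt_le_mono)
        have r: "?r N > 0" using c_pos[of N] elim by simp
        have "(collision_gf ((c N)\<^sup>2) N x\<^sub>0 x\<^sub>0 - 1 - ?r N) / ?r N \<le> ((?r N)\<^sup>2 / (1 - ?r N)) / ?r N"
          using r elim by (intro divide_right_mono collision_gf_remainder x0) auto
        also have "\<dots> = ?r N / (1 - ?r N)"
          using r by (simp add: power2_eq_square)
        finally show "(collision_gf ((c N)\<^sup>2) N x\<^sub>0 x\<^sub>0 - 1 - ?r N) / ?r N \<le> ?r N / (1 - ?r N)" .
      qed simp
      finally show ?case .
    qed
    have "(\<lambda>N. \<bar>t\<bar> * sqrt (?r N / (1 - ?r N))) \<longlonglongrightarrow> \<bar>t\<bar> * sqrt (0 / (1 - 0))"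
      by (intro tendsto_intros cR) auto
    then show "(\<lambda>N. \<bar>t\<bar> * sqrt (?r N / (1 - ?r N))) \<longlonglongrightarrow> 0" by simp
  qed
  from tendsto_add[OF this char_first_order[OF R, of t]]
  show "(\<lambda>N. char (distr Q borel (?X N)) t) \<longlonglongrightarrow> char std_normal_distribution t" by simp
qed

end

section \<open>Simple random walk in dimensions one and two\<close>

definition return_prob :: "nat \<Rightarrow> real" where
  "return_prob n = real ((2 * n) choose n) / 4 ^ n"

lemma return_prob_Suc: "return_prob (Suc n) = return_prob n * ((2 * real n + 1) / (2 * real n + 2))"
proof -
  have 1: "Suc n * ((2 * Suc n) choose Suc n) = (2 * Suc n) * ((2 * n + 1) choose n)"
    using Suc_times_binomial_eq[of "2 * n + 1" n] by simp
  have 2: "Suc n * ((2 * n + 1) choose n) = (2 * n + 1) * ((2 * n) choose n)"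
    using Suc_times_binomial_eq[of "2 * n" n] binomial_symmetric[of n "2 * n + 1"] by simp
  have "real (Suc n) * real ((2 * Suc n) choose Suc n) = 2 * (real (Suc n) * real ((2 * n + 1) choose n))"
    using arg_cong[OF 1, of real] by (simp only: of_nat_mult)
  also have "\<dots> = 2 * (real (2 * n + 1) * real ((2 * n) choose n))"
    using arg_cong[OF 2, of real] by (simp only: of_nat_mult)
  finally have "real ((2 * Suc n) choose Suc n) = 2 * (real (2 * n + 1) * real ((2 * n) choose n)) / real (Suc n)"
    by (metis nonzero_mult_div_cancel_left of_nat_neq_0)
  moreover have "2 * real n + 2 = 2 * real (Suc n)" "2 * real n + 1 = real (2 * n + 1)" by simp_all
  ultimately show ?thesis
    unfolding return_prob_def by (simp add: ac_simps del: binomial_Suc_Suc mult_Suc_right of_nat_Suc)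
qed

lemma return_prob_nonneg: "return_prob n \<ge> 0"
  by (simp add: return_prob_def)

lemma return_prob_sq_le: "(return_prob n)\<^sup>2 * (2 * real n + 1) \<le> 1"
proof (induction n)
  case (Suc n)
  have "(return_prob (Suc n))\<^sup>2 * (2 * real (Suc n) + 1)
      = ((return_prob n)\<^sup>2 * (2 * real n + 1)) * ((2 * real n + 1) * (2 * real n + 3) / (2 * real n + 2)\<^sup>2)"
    by (simp add: return_prob_Suc power2_eq_square field_simps)
  also have "\<dots> \<le> 1 * 1"
  proof (intro mult_mono Suc)
    show "(2 * real n + 1) * (2 * real n + 3) / (2 * real n + 2)\<^sup>2 \<le> 1"
      by (rule divide_le_eq_1[THEN iffD2]) (auto simp: power2_eq_square algebra_simps add_pos_nonneg)
  qed auto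
  finally show ?case by simp
qed (simp add: return_prob_def)

lemma return_prob_sq_ge: "(return_prob (Suc n))\<^sup>2 * (4 * real (Suc n)) \<ge> 1"
proof (induction n)
  case (Suc n)
  have "1 * 1 \<le> ((return_prob (Suc n))\<^sup>2 * (4 * real (Suc n))) * ((2 * real n + 3)\<^sup>2 / (4 * (real n + 1) * (real n + 2)))"
  proof (intro mult_mono Suc)
    show "1 \<le> (2 * real n + 3)\<^sup>2 / (4 * (real n + 1) * (real n + 2))"
      by (rule le_divide_eq_1[THEN iffD2]) (auto simp: power2_eq_square algebra_simps add_pos_nonneg)
  qed auto
  also have "\<dots> = (return_prob (Suc (Suc n)))\<^sup>2 * (4 * real (Suc (Suc n)))"
    unfolding return_prob_Suc[of "Suc n"]
    by (simp add: power2_eq_square divide_simps) (simp add: algebra_simps)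
  finally show ?case by simp
qed (simp add: return_prob_def power2_eq_square)

lemma return_prob_sq_upper: "(return_prob (Suc n))\<^sup>2 \<le> 1 / real (Suc n)"
proof -
  have "(return_prob (Suc n))\<^sup>2 * real (Suc n) \<le> (return_prob (Suc n))\<^sup>2 * (2 * real (Suc n) + 1)"
    by (intro mult_left_mono) auto
  also have "\<dots> \<le> 1" by (rule return_prob_sq_le)
  finally show ?thesis by (simp add: field_simps)
qed

lemma return_prob_sq_lower: "1 / (4 * real (Suc n)) \<le> (return_prob (Suc n))\<^sup>2"
  using return_prob_sq_ge[of n] by (simp add: field_simps)

lemma sum_return_prob_upper: "(\<Sum>i<N. return_prob (Suc i)) \<le> 2 * sqrt (real N)"
proof (induction N)
  case (Suc N)
  have "return_prob (Suc N) \<le> 1 / sqrt (real (Suc N))"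
    using return_prob_sq_upper[of N] real_le_rsqrt by (fastforce simp: real_sqrt_divide)
  also have "\<dots> \<le> 2 * sqrt (real (Suc N)) - 2 * sqrt (real N)"
  proof -
    define a b where "a = sqrt (real (Suc N))" and "b = sqrt (real N)"
    have ab: "a\<^sup>2 = b\<^sup>2 + 1" "a > 0" "b \<ge> 0" by (auto simp: a_def b_def)
    have "2 * a * b \<le> a\<^sup>2 + b\<^sup>2" by (rule sum_squares_bound)
    then have "1 \<le> (2 * a - 2 * b) * a" using ab by (simp add: algebra_simps power2_eq_square)
    then show ?thesis using ab unfolding a_def[symmetric] b_def[symmetric] by (simp add: field_simps)
  qed
  finally show ?case using Suc by simp
qed simp

lemma harm_eq: "harm N = (\<Sum>i<N. 1 / real (Suc i))"
  by (simp add: harm_def sum.atLeast1_atMost_eq inverse_eq_divide)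

lemma sum_return_prob_sq_upper: "(\<Sum>i<N. (return_prob (Suc i))\<^sup>2) \<le> harm N"
  unfolding harm_eq by (intro sum_mono return_prob_sq_upper)

lemma sum_return_prob_sq_lower: "harm N / 4 \<le> (\<Sum>i<N. (return_prob (Suc i))\<^sup>2)"
proof -
  have "harm N / 4 = (\<Sum>i<N. 1 / (4 * real (Suc i)))"
    by (simp add: harm_eq sum_divide_distrib mult.commute)
  also have "\<dots> \<le> (\<Sum>i<N. (return_prob (Suc i))\<^sup>2)"
    by (intro sum_mono return_prob_sq_lower)
  finally show ?thesis .
qed

lemma sum_return_prob_sq_at_top: "filterlim (\<lambda>N. \<Sum>i<N. (return_prob (Suc i))\<^sup>2) at_top sequentially"
proof (rule filterlim_at_top_mono)
  show "filterlim (\<lambda>N. 1 / 4 * harm N :: real) at_top sequentially"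
    by (intro filterlim_tendsto_pos_mult_at_top[OF tendsto_const] harm_at_top) auto
qed (use sum_return_prob_sq_lower in \<open>auto simp: field_simps\<close>)

lemma sum_return_prob_at_top: "filterlim (\<lambda>N. \<Sum>i<N. return_prob (Suc i)) at_top sequentially"
proof (rule filterlim_at_top_mono[OF sum_return_prob_sq_at_top])
  have "return_prob (Suc i) \<le> 1" for i
  proof -
    have "(return_prob (Suc i))\<^sup>2 \<le> 1\<^sup>2"
      using return_prob_sq_upper[of i] by (rule order_trans) simp
    then show ?thesis by (rule power2_le_imp_le) simp
  qed
  then have "(return_prob (Suc i))\<^sup>2 \<le> return_prob (Suc i)" for i
    using mult_left_mono[of "return_prob (Suc i)" 1 "return_prob (Suc i)"] return_prob_nonneg
    by (simp add: power2_eq_square)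
  then show "\<forall>\<^sub>F N in sequentially. (\<Sum>i<N. (return_prob (Suc i))\<^sup>2) \<le> (\<Sum>i<N. return_prob (Suc i))"
    by (intro always_eventually allI sum_mono)
qed

lemma scaled_sum_return_prob:
  fixes c :: "nat \<Rightarrow> real"
  assumes "(\<lambda>N. (c N)\<^sup>2 * sqrt (real N)) \<longlonglongrightarrow> 0"
  shows "(\<lambda>N. (c N)\<^sup>2 * (\<Sum>i<N. return_prob (Suc i))) \<longlonglongrightarrow> 0"
proof (rule Lim_null_comparison)
  show "(\<lambda>N. 2 * ((c N)\<^sup>2 * sqrt (real N))) \<longlonglongrightarrow> 0"
    using tendsto_mult_left[OF assms, of 2] by simp
  show "\<forall>\<^sub>F N in sequentially. norm ((c N)\<^sup>2 * (\<Sum>i<N. return_prob (Suc i))) \<le> 2 * ((c N)\<^sup>2 * sqrt (real N))"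
  proof (intro always_eventually allI)
    fix N
    have "(c N)\<^sup>2 * (\<Sum>i<N. return_prob (Suc i)) \<le> (c N)\<^sup>2 * (2 * sqrt (real N))"
      by (intro mult_left_mono sum_return_prob_upper) simp
    then show "norm ((c N)\<^sup>2 * (\<Sum>i<N. return_prob (Suc i))) \<le> 2 * ((c N)\<^sup>2 * sqrt (real N))"
      by (simp add: abs_mult sum_nonneg return_prob_nonneg)
  qed
qed

lemma scaled_sum_return_prob_sq:
  fixes c :: "nat \<Rightarrow> real"
  assumes "(\<lambda>N. (c N)\<^sup>2 * ln (real N)) \<longlonglongrightarrow> 0"
  shows "(\<lambda>N. (c N)\<^sup>2 * (\<Sum>i<N. (return_prob (Suc i))\<^sup>2)) \<longlonglongrightarrow> 0"
proof (rule Lim_null_comparison)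
  show "(\<lambda>N. 2 * ((c N)\<^sup>2 * ln (real N))) \<longlonglongrightarrow> 0"
    using tendsto_mult_left[OF assms, of 2] by simp
  have "\<forall>\<^sub>F N in sequentially. ln (real N) \<ge> 1"
    using filterlim_compose[OF ln_at_top filterlim_real_sequentially]
    by (auto simp: filterlim_at_top)
  with eventually_gt_at_top[of 0]
  show "\<forall>\<^sub>F N in sequentially. norm ((c N)\<^sup>2 * (\<Sum>i<N. (return_prob (Suc i))\<^sup>2)) \<le> 2 * ((c N)\<^sup>2 * ln (real N))"
  proof eventually_elim
    case (elim N)
    have "harm N - ln (real N) \<le> harm 1 - ln (real 1)"
      using elim euler_mascheroni_sequence_decreasing[of 1 N] by simp
    then have "harm N \<le> 2 * ln (real N)" using elim by (simp add: harm_expand)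
    then have "(c N)\<^sup>2 * (\<Sum>i<N. (return_prob (Suc i))\<^sup>2) \<le> (c N)\<^sup>2 * (2 * ln (real N))"
      using sum_return_prob_sq_upper[of N] by (intro mult_left_mono) auto
    then show ?case
      by (simp add: abs_mult sum_nonneg)
  qed
qed

lemma sum_binomial_Suc:
  fixes f :: "nat \<Rightarrow> real"
  shows "(\<Sum>k\<le>Suc n. real (Suc n choose k) * f k) = (\<Sum>k\<le>n. real (n choose k) * (f k + f (Suc k)))"
proof -
  have "(\<Sum>k\<le>Suc n. real (Suc n choose k) * f k)
      = f 0 + (\<Sum>k\<le>n. real (n choose Suc k) * f (Suc k)) + (\<Sum>k\<le>n. real (n choose k) * f (Suc k))"
    by (simp add: sum.atMost_Suc_shift algebra_simps sum.distrib del: sum.atMost_Suc)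
  also have "f 0 + (\<Sum>k\<le>n. real (n choose Suc k) * f (Suc k)) = (\<Sum>k\<le>Suc n. real (n choose k) * f k)"
    by (simp add: sum.atMost_Suc_shift del: sum.atMost_Suc)
  also have "\<dots> = (\<Sum>k\<le>n. real (n choose k) * f k)"
    by simp
  finally show ?thesis by (simp add: algebra_simps sum.distrib)
qed

lemma sum_binomial_weights_sq: "(\<Sum>k\<le>n. (real (n choose k) / 2 ^ n)\<^sup>2) = return_prob n"
proof -
  have "(\<Sum>k\<le>n. (real (n choose k) / 2 ^ n)\<^sup>2) = real (\<Sum>k\<le>n. (n choose k)\<^sup>2) / 4 ^ n"
    by (simp add: power_divide sum_divide_distrib power2_eq_square flip: power_mult_distrib)
  then show ?thesis by (simp only: choose_square_sum return_prob_def)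
qed

lemma (in step_kernel) paths_iff:
  "l \<in> paths n x \<longleftrightarrow> length l = n \<and> (\<forall>i<n. l ! i \<in> nb ((x # l) ! i))"
proof (induction n arbitrary: x l)
  case (Suc n)
  show ?case
  proof (cases l)
    case (Cons y l')
    have "l \<in> paths (Suc n) x \<longleftrightarrow> y \<in> nb x \<and> l' \<in> paths n y"
      by (auto simp: Cons)
    also have "\<dots> \<longleftrightarrow> length l = Suc n \<and> (\<forall>i<Suc n. l ! i \<in> nb ((x # l) ! i))"
      by (auto simp: Suc Cons All_less_Suc2)
    finally show ?thesis .
  qed auto
qed auto

lemma partition_fn_eq_path_mean:
  assumes k: "step_kernel (lattice d) (\<lambda>x. Collect (nn x)) D"
  shows "partition_fn d c g N = step_kernel.path_mean (\<lambda>x. Collect (nn x)) D N (replicate d 0)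
    (\<lambda>l. \<Prod>i<N. 1 + c N * g (Suc i) (l ! i))"
proof -
  interpret step_kernel "lattice d" "\<lambda>x. Collect (nn x)" D by (rule k)
  let ?o = "replicate d (0::int)"
  have o: "?o \<in> lattice d" by (simp add: lattice_def)
  have reindex: "(\<Sum>\<omega>\<in>walks d N. F (map \<omega> [1..<Suc N])) = (\<Sum>l\<in>paths N ?o. F l)" for F :: "int list list \<Rightarrow> real"
  proof (rule sum.reindex_bij_witness[where i = "\<lambda>l. restrict (\<lambda>i. (?o # l) ! i) {0..N}"
        and j = "\<lambda>\<omega>. map \<omega> [1..<Suc N]"])
    fix \<omega> assume \<omega>: "\<omega> \<in> walks d N"
    have cons: "(?o # map \<omega> [1..<Suc N]) ! i = \<omega> i" if "i \<le> N" for i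
      using \<omega> that by (cases i) (auto simp: walks_def nth_append simp del: upt_Suc)
    show "restrict (\<lambda>i. (?o # map \<omega> [1..<Suc N]) ! i) {0..N} = \<omega>"
      using \<omega> cons by (intro extensionalityI[of _ "{0..N}"]) (auto simp: walks_def PiE_def)
    have "nn (\<omega> i) (\<omega> (Suc i))" if "i < N" for i
      using \<omega> that by (auto simp: walks_def dest!: bspec[of _ _ "Suc i"])
    then show "map \<omega> [1..<Suc N] \<in> paths N ?o"
      unfolding paths_iff using cons by (auto simp del: upt_Suc)
  next
    fix l assume l: "l \<in> paths N ?o"
    have len: "length l = N" using l by (rule paths_length)
    show "map (restrict (\<lambda>i. (?o # l) ! i) {0..N}) [1..<Suc N] = l"
      by (rule nth_equalityI) (auto simp: len simp del: upt_Suc)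
    have "nn ((?o # l) ! (n - 1)) ((?o # l) ! n)" if "n \<in> {1..N}" for n
      using l that unfolding paths_iff by (cases n) auto
    moreover have "(?o # l) ! n \<in> lattice d" if "n \<le> N" for n
      using paths_nth[OF o l] o that by (cases n) auto
    ultimately show "restrict (\<lambda>i. (?o # l) ! i) {0..N} \<in> walks d N"
      by (auto simp: walks_def)
  qed simp
  have prod_eq: "(\<Prod>n=1..N. 1 + c N * g n (\<omega> n)) = (\<Prod>i<N. 1 + c N * g (Suc i) (map \<omega> [1..<Suc N] ! i))" for \<omega>
    by (simp add: prod.atLeast1_atMost_eq del: upt_Suc)
  have "real (card (walks d N)) = real D ^ N"
    using reindex[of "\<lambda>_. 1"] card_paths[OF o, of N] by simp
  then show ?thesis
    unfolding partition_fn_def path_mean_def prod_eq reindex[of "\<lambda>l. \<Prod>i<N. 1 + c N * g (Suc i) (l ! i)"]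
    by simp
qed

lemma lattice_1_cases: "x \<in> lattice (Suc 0) \<Longrightarrow> (\<And>a. x = [a] \<Longrightarrow> P) \<Longrightarrow> P"
  by (auto simp: lattice_def length_Suc_conv)

lemma lattice_2_cases: "x \<in> lattice 2 \<Longrightarrow> (\<And>a b. x = [a, b] \<Longrightarrow> P) \<Longrightarrow> P"
  by (auto simp: lattice_def length_Suc_conv numeral_2_eq_2)

lemma nn_1: "Collect (nn [a]) = {[a - 1], [a + 1]}"
proof -
  have "nn [a] y \<longleftrightarrow> y \<in> {[a - 1], [a + 1]}" for y
    by (cases y) (auto simp: nn_def abs_if split: if_splits)
  then show ?thesis by blast
qed

lemma nn_2: "Collect (nn [a, b]) = {[a - 1, b], [a, b - 1], [a, b + 1], [a + 1, b]}"
proof -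
  have "nn [a, b] y \<longleftrightarrow> y \<in> {[a - 1, b], [a, b - 1], [a, b + 1], [a + 1, b]}" for y
  proof (cases "length y = 2")
    case True
    then obtain u v where "y = [u, v]" by (auto simp: length_Suc_conv numeral_2_eq_2)
    then show ?thesis by (simp add: nn_def numeral_2_eq_2) arith
  qed (auto simp: nn_def)
  then show ?thesis by blast
qed

interpretation line: step_kernel "lattice 1" "\<lambda>x. Collect (nn x)" 2
proof
  show "y \<in> lattice 1" if "x \<in> lattice 1" "y \<in> Collect (nn x)" for x y
    using that by (auto simp: lattice_def nn_def)
qed (auto elim!: lattice_1_cases simp: nn_1)

interpretation plane: step_kernel "lattice 2" "\<lambda>x. Collect (nn x)" 4
proof
  show "y \<in> lattice 2" if "x \<in> lattice 2" "y \<in> Collect (nn x)" for x y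
    using that by (auto simp: lattice_def nn_def)
qed (auto elim!: lattice_2_cases simp: nn_2)

interpretation line: explicit_kernel "lattice 1" "\<lambda>x. Collect (nn x)" 2 "\<lambda>n. {..n}"
  "\<lambda>n k. real (n choose k) / 2 ^ n" "\<lambda>n x k. [x ! 0 + 2 * int k - int n]"
proof
  show "(line.avg ^^ n) f x = (\<Sum>k\<le>n. real (n choose k) / 2 ^ n * f [x ! 0 + 2 * int k - int n])"
    if "x \<in> lattice 1" for n f x
    using that
  proof (induction n arbitrary: x)
    case 0
    then show ?case by (auto elim!: lattice_1_cases)
  next
    case (Suc n)
    then obtain a where x: "x = [a]" by (auto elim: lattice_1_cases)
    have "(line.avg ^^ Suc n) f x = ((line.avg ^^ n) f [a - 1] + (line.avg ^^ n) f [a + 1]) / 2"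
      by (simp add: line.avg_def x nn_1)
    also have "\<dots> = (\<Sum>k\<le>n. real (n choose k) *
        (f [a + 2 * int k - int (Suc n)] + f [a + 2 * int (Suc k) - int (Suc n)])) / 2 ^ Suc n"
      by (simp add: Suc.IH lattice_def algebra_simps sum.distrib sum_divide_distrib add_divide_distrib)
    also have "\<dots> = (\<Sum>k\<le>Suc n. real (Suc n choose k) * f [a + 2 * int k - int (Suc n)]) / 2 ^ Suc n"
      by (simp only: sum_binomial_Suc)
    finally show ?case by (simp only: x sum_divide_distrib nth_Cons_0 times_divide_eq_left)
  qed
qed (auto simp: lattice_def inj_on_def)

text \<open>The plane walk is a pair of independent line walks in the coordinates \<open>x + y\<close> and \<open>x - y\<close>.\<close>

interpretation plane: explicit_kernel "lattice 2" "\<lambda>x. Collect (nn x)" 4 "\<lambda>n. {..n} \<times> {..n}"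
  "\<lambda>n (k, j). real (n choose k) / 2 ^ n * (real (n choose j) / 2 ^ n)"
  "\<lambda>n x (k, j). [x ! 0 + int k + int j - int n, x ! 1 + int k - int j]"
proof
  have "(plane.avg ^^ n) f x = (\<Sum>k\<le>n. real (n choose k) * (\<Sum>j\<le>n. real (n choose j) *
      f [x ! 0 + int k + int j - int n, x ! 1 + int k - int j])) / 4 ^ n"
    if "x \<in> lattice 2" for n f x
    using that
  proof (induction n arbitrary: x)
    case 0
    then show ?case by (auto elim!: lattice_2_cases)
  next
    case (Suc n)
    then obtain a b where x: "x = [a, b]" by (auto elim: lattice_2_cases)
    let ?f = "\<lambda>k j. f [a + int k + int j - int (Suc n), b + int k - int j]"
    have "(plane.avg ^^ Suc n) f x = ((plane.avg ^^ n) f [a - 1, b] + (plane.avg ^^ n) f [a, b - 1]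
        + (plane.avg ^^ n) f [a, b + 1] + (plane.avg ^^ n) f [a + 1, b]) / 4"
      by (simp add: plane.avg_def x nn_2)
    also have "\<dots> = (\<Sum>k\<le>n. real (n choose k) * ((\<Sum>j\<le>n. real (n choose j) * (?f k j + ?f k (Suc j)))
        + (\<Sum>j\<le>n. real (n choose j) * (?f (Suc k) j + ?f (Suc k) (Suc j))))) / 4 ^ Suc n"
      by (simp add: Suc.IH lattice_def algebra_simps sum.distrib add_divide_distrib)
    also have "\<dots> = (\<Sum>k\<le>Suc n. real (Suc n choose k) * (\<Sum>j\<le>Suc n. real (Suc n choose j) * ?f k j)) / 4 ^ Suc n"
      by (simp only: sum_binomial_Suc)
    finally show ?case by (simp add: x)
  qed
  then show "(plane.avg ^^ n) f x = (\<Sum>p\<in>{..n} \<times> {..n}.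
      (case p of (k, j) \<Rightarrow> real (n choose k) / 2 ^ n * (real (n choose j) / 2 ^ n)) *
      f (case p of (k, j) \<Rightarrow> [x ! 0 + int k + int j - int n, x ! 1 + int k - int j]))"
    if "x \<in> lattice 2" for n f x
    using that
    by (simp add: sum.cartesian_product' sum_distrib_left sum_divide_distrib
        mult.assoc flip: power_mult_distrib)
qed (auto simp: lattice_def inj_on_def)

lemma overlap_line: "line.overlap N = (\<Sum>i<N. return_prob (Suc i))"
  by (simp add: line.overlap_def sum_binomial_weights_sq del: binomial_Suc_Suc power_Suc sum.atMost_Suc)

lemma overlap_plane: "plane.overlap N = (\<Sum>i<N. (return_prob (Suc i))\<^sup>2)"
proof -
  have "(\<Sum>p\<in>{..n} \<times> {..n}. (case p of (k, j) \<Rightarrow> real (n choose k) / 2 ^ n * (real (n choose j) / 2 ^ n))\<^sup>2)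
      = (return_prob n)\<^sup>2" for n
    unfolding sum_binomial_weights_sq[symmetric] power2_eq_square[of "sum _ _"] sum_product sum.cartesian_product
    by (intro sum.cong) (auto simp: power2_eq_square)
  then show ?thesis by (simp only: plane.overlap_def)
qed

theorem theorem28:
  fixes Q :: "'h measure"
    and h :: "'h \<Rightarrow> nat \<Rightarrow> int list \<Rightarrow> real"
    and c :: "nat \<Rightarrow> real"
    and d :: nat
  assumes d: "d \<in> {1, 2}"
    and Q: "prob_space Q"
    and indep: "prob_space.indep_vars Q (\<lambda>_. borel) (\<lambda>(n, x) \<eta>. h \<eta> n x) (UNIV \<times> lattice d)"
    and pm1: "\<And>n x. x \<in> lattice d \<Longrightarrow> AE \<eta> in Q. h \<eta> n x \<in> {-1, 1}"
    and half: "\<And>n x. x \<in> lattice d \<Longrightarrow> measure Q {\<eta> \<in> space Q. h \<eta> n x = 1} = 1 / 2"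
    and c_pos: "\<And>N. c N > 0"
    and c1: "d = 1 \<Longrightarrow> (\<lambda>N. (c N)\<^sup>2 * sqrt (real N)) \<longlonglongrightarrow> 0"
    and c2: "d = 2 \<Longrightarrow> (\<lambda>N. (c N)\<^sup>2 * ln (real N)) \<longlonglongrightarrow> 0"
  shows "\<exists>(a :: nat \<Rightarrow> real) (\<mu> :: real) (\<sigma> :: real). \<sigma> > 0 \<and>
    weak_conv_m (\<lambda>N. distr Q borel (\<lambda>\<eta>. a N * (partition_fn d c (h \<eta>) N - 1)))
                (density lborel (normal_density \<mu> \<sigma>))"
proof -
  have signs: "random_signs Q (\<lambda>(n, x) \<eta>. h \<eta> n x) (UNIV \<times> lattice d)"
    using Q indep pm1 half by (auto simp: random_signs_def random_signs_axioms_def)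
  have "\<exists>a. weak_conv_m (\<lambda>N. distr Q borel (\<lambda>\<eta>. a N * (partition_fn d c (h \<eta>) N - 1))) std_normal_distribution"
  proof (cases "d = 1")
    case True
    interpret random_signs Q "\<lambda>(n, x) \<eta>. h \<eta> n x" "UNIV \<times> lattice 1"
      using signs True by simp
    interpret polymer "lattice 1" "\<lambda>x. Collect (nn x)" 2 "\<lambda>n. {..n}"
      "\<lambda>n k. real (n choose k) / 2 ^ n" "\<lambda>n x k. [x ! 0 + 2 * int k - int n]" Q h "replicate 1 0"
      by unfold_locales (simp add: lattice_def)
    have Z: "partition_fn d c (h \<eta>) N = partition_function (c N) N \<eta>" for N \<eta>
      unfolding partition_function_def weight_def True
      by (rule partition_fn_eq_path_mean[OF line.step_kernel_axioms])
    have "filterlim line.overlap at_top sequentially"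
      unfolding overlap_line[abs_def] by (rule sum_return_prob_at_top)
    moreover have "(\<lambda>N. (c N)\<^sup>2 * line.overlap N) \<longlonglongrightarrow> 0"
      unfolding overlap_line by (rule scaled_sum_return_prob[OF c1[OF True]])
    ultimately show ?thesis
      unfolding Z using partition_function_clt[of c] c_pos
      by (intro exI[of _ "\<lambda>N. 1 / (c N * sqrt (line.overlap N))"]) blast
  next
    case False
    then have d2: "d = 2" using d by simp
    interpret random_signs Q "\<lambda>(n, x) \<eta>. h \<eta> n x" "UNIV \<times> lattice 2"
      using signs d2 by simp
    interpret polymer "lattice 2" "\<lambda>x. Collect (nn x)" 4 "\<lambda>n. {..n} \<times> {..n}"
      "\<lambda>n (k, j). real (n choose k) / 2 ^ n * (real (n choose j) / 2 ^ n)"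
      "\<lambda>n x (k, j). [x ! 0 + int k + int j - int n, x ! 1 + int k - int j]" Q h "replicate 2 0"
      by unfold_locales (simp add: lattice_def)
    have Z: "partition_fn d c (h \<eta>) N = partition_function (c N) N \<eta>" for N \<eta>
      unfolding partition_function_def weight_def d2
      by (rule partition_fn_eq_path_mean[OF plane.step_kernel_axioms])
    have "filterlim plane.overlap at_top sequentially"
      unfolding overlap_plane[abs_def] by (rule sum_return_prob_sq_at_top)
    moreover have "(\<lambda>N. (c N)\<^sup>2 * plane.overlap N) \<longlonglongrightarrow> 0"
      unfolding overlap_plane by (rule scaled_sum_return_prob_sq[OF c2[OF d2]])
    ultimately show ?thesis
      unfolding Z using partition_function_clt[of c] c_pos
      by (intro exI[of _ "\<lambda>N. 1 / (c N * sqrt (plane.overlap N))"]) blast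
  qed
  then obtain a where "weak_conv_m (\<lambda>N. distr Q borel (\<lambda>\<eta>. a N * (partition_fn d c (h \<eta>) N - 1)))
      std_normal_distribution" ..
  then show ?thesis by (intro exI[of _ a] exI[of _ 0] exI[of _ 1] conjI zero_less_one)
qed

end
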